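(* Let $M=(S,A,P,R,\gamma,\rho)$ be a Markov decision process with finite state space $S$ and discount factor $\gamma\in[0,1)$, let $\lambda\in[0,1)$, let $\pi$ be a target policy and $\mu$ a behavior policy, let $d_\mu$ be the stationary distribution over states induced by $\mu$, and let $i:S\to\mathbb{R}^+$ be a given function. Put $\mathbf{i}(s)=i(s)\,d_\mu(s)$, $$P^\lambda_\pi = I-(I-\gamma\lambda P_\pi)^{-1}(I-\gamma P_\pi),\qquad m^\top=\mathbf{i}^\top (I-P^\lambda_\pi)^{-1},$$ where $m>0$ element-wise, and $$T^{(\lambda)}v=(I-\gamma\lambda P_\pi)^{-1}R_\pi+P^\lambda_\pi v .$$ Let $\Pi_m$ be the projection onto the linear subspace of $\mathbb{R}^{|S|}$ spanned by the features, with respect to the $m$-weighted Euclidean norm. Then, with $\beta=\frac{\gamma(1-\lambda)}{1-\lambda\gamma}$, $\Pi_m T^{(\lambda)}$ is a $\sqrt{\beta}$-contraction with respect to the $m$-weighted Euclidean norm, namely $$\|\Pi_m T^{(\lambda)}v_1-\Pi_m T^{(\lambda)}v_2\|_m\le\sqrt{\beta}\,\|v_1-v_2\|_m,\qquad\forall v_1,v_2\in\mathbb{R}^{|S|}.$$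
   Context: In $M=(S,A,P,R,\gamma,\rho)$, $S$ is the state space, $A$ the action space, $P$ the transition probabilities, $R$ the reward function, $\gamma$ the discount factor and $\rho$ the initial state distribution. A policy $\pi$ assigns to each state $s$ a probability distribution $\pi(\cdot|s)$ on $A$. The matrix $P_\pi\in\mathbb{R}^{|S|\times|S|}$, with entries $P_\pi(s'|s)=\sum_a\pi(a|s)P(s'|s,a)$ (row $s$, column $s'$), and the vector $R_\pi\in\mathbb{R}^{|S|}$, with entries $R_\pi(s)=\sum_a\pi(a|s)R(s,a)$, are the (row-stochastic) transition matrix and reward vector induced by $\pi$; $P_\mu$ is defined likewise. The stationary distribution $d_\mu$ is a probability vector with $d_\mu^\top P_\mu=d_\mu^\top$. The behavior policy generates samples by $a_t\sim\mu(\cdot|s_t)$, $s_{t+1}\sim P(\cdot|s_t,a_t)$, and the ratios $\pi(a_t|s_t)/\mu(a_t|s_t)$ are assumed to be well-defined for all $t$. $\mathbb{R}^+$ denotes the nonnegative reals; $i(s)$ signifies the importance of state $s$. Each state $s$ has a feature vector $\phi(s)\in\mathbb{R}^n$, and $\Phi\in\mathbb{R}^{n\times|S|}$ is the matrix whose columns are the feature vectors of all states. The subspace spanned by the features is $\{\Phi^\top\theta:\theta\in\mathbb{R}^n\}\subseteq\mathbb{R}^{|S|}$. For $d\in\mathbb{R}^{|S|}$ with $d>0$ element-wise, the $d$-weighted Euclidean norm is $\|v\|_d=\big(\sum_s d(s)v(s)^2\big)^{1/2}$, and $\Pi_d$ is the orthogonal projection onto that subspace with respect to this norm (i.e. $\Pi_d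 v$ is the minimizer of $\|u-v\|_d$ over $u$ in the subspace). *)

theory Defs
  imports "HOL-Probability.Probability"
begin

text \<open>
  The state space is the finite type \<open>'s\<close> and the action space the type \<open>'a\<close>. Policies and
  transition probabilities are given by probability mass functions: \<open>pmf (\<pi> s) a\<close> is
  $\pi(a|s)$ and \<open>pmf (P s a) s'\<close> is $P(s'|s,a)$. No finiteness of \<open>'a\<close> is required, so sums
  over actions are \<open>infsum\<close>s; for finite \<open>'a\<close> they are ordinary finite sums.
\<close>

definition trans_matrix ::
    "('s::finite \<Rightarrow> 'a \<Rightarrow> 's pmf) \<Rightarrow> ('s \<Rightarrow> 'a pmf) \<Rightarrow> real ^ 's ^ 's" where
  "trans_matrix P \<pi> = (\<chi> s s'. \<Sum>\<^sub>\<infinity>a. pmf (\<pi> s) a * pmf (P s a) s')"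

definition reward_vector ::
    "('s::finite \<Rightarrow> 'a \<Rightarrow> real) \<Rightarrow> ('s \<Rightarrow> 'a pmf) \<Rightarrow> real ^ 's" where
  "reward_vector R \<pi> = (\<chi> s. \<Sum>\<^sub>\<infinity>a. pmf (\<pi> s) a * R s a)"

definition stationary_distribution :: "real ^ 's ^ 's \<Rightarrow> real ^ 's::finite \<Rightarrow> bool" where
  "stationary_distribution Q d \<longleftrightarrow>
     (\<forall>s. 0 \<le> d $ s) \<and> (\<Sum>s\<in>UNIV. d $ s) = 1 \<and> d v* Q = d"

text \<open>Distribution of $s_t$ when $s_0 \sim \rho$, $a_t \sim \mu(\cdot|s_t)$ and
  $s_{t+1} \sim P(\cdot|s_t,a_t)$.\<close>

primrec state_dist ::
    "('s \<Rightarrow> 'a \<Rightarrow> 's pmf) \<Rightarrow> 's pmf \<Rightarrow> ('s \<Rightarrow> 'a pmf) \<Rightarrow> nat \<Rightarrow> 's pmf" where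
  "state_dist P \<rho> \<mu> 0 = \<rho>"
| "state_dist P \<rho> \<mu> (Suc t) =
     bind_pmf (state_dist P \<rho> \<mu> t) (\<lambda>s. bind_pmf (\<mu> s) (\<lambda>a. P s a))"

text \<open>The ratios $\pi(a|s_t)/\mu(a|s_t)$ have a nonzero denominator for every action that the
  target policy may take in a state that the behavior policy may visit.\<close>

definition ratios_well_defined ::
    "('s \<Rightarrow> 'a \<Rightarrow> 's pmf) \<Rightarrow> 's pmf \<Rightarrow> ('s \<Rightarrow> 'a pmf) \<Rightarrow> ('s \<Rightarrow> 'a pmf) \<Rightarrow> bool" where
  "ratios_well_defined P \<rho> \<pi> \<mu> \<longleftrightarrow>
     (\<forall>t. \<forall>s\<in>set_pmf (state_dist P \<rho> \<mu> t). \<forall>a. pmf (\<pi> s) a \<noteq> 0 \<longrightarrow> pmf (\<mu> s) a \<noteq> 0)"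

definition lambda_matrix :: "real \<Rightarrow> real \<Rightarrow> real ^ 's ^ 's \<Rightarrow> real ^ 's ^ 's::finite" where
  "lambda_matrix \<gamma> lam Q =
     mat 1 - matrix_inv (mat 1 - (\<gamma> * lam) *\<^sub>R Q) ** (mat 1 - \<gamma> *\<^sub>R Q)"

definition emphasis ::
    "real \<Rightarrow> real \<Rightarrow> real ^ 's ^ 's \<Rightarrow> ('s \<Rightarrow> real) \<Rightarrow> real ^ 's \<Rightarrow> real ^ 's::finite" where
  "emphasis \<gamma> lam Q i d = (\<chi> s. i s * d $ s) v* matrix_inv (mat 1 - lambda_matrix \<gamma> lam Q)"

definition bellman_lambda ::
    "real \<Rightarrow> real \<Rightarrow> real ^ 's ^ 's \<Rightarrow> real ^ 's \<Rightarrow> real ^ 's \<Rightarrow> real ^ 's::finite" where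
  "bellman_lambda \<gamma> lam Q r v =
     matrix_inv (mat 1 - (\<gamma> * lam) *\<^sub>R Q) *v r + lambda_matrix \<gamma> lam Q *v v"

definition feature_matrix :: "('s::finite \<Rightarrow> real ^ 'n::finite) \<Rightarrow> real ^ 's ^ 'n" where
  "feature_matrix \<phi> = (\<chi> j s. \<phi> s $ j)"

definition feature_space :: "('s::finite \<Rightarrow> real ^ 'n::finite) \<Rightarrow> (real ^ 's) set" where
  "feature_space \<phi> = range (\<lambda>\<theta>. transpose (feature_matrix \<phi>) *v \<theta>)"

definition wnorm :: "real ^ 's \<Rightarrow> real ^ 's::finite \<Rightarrow> real" where
  "wnorm d v = sqrt (\<Sum>s\<in>UNIV. d $ s * (v $ s)\<^sup>2)"

text \<open>If all entries of \<open>d\<close> are positive and \<open>U\<close> is a subspace, then the minimizer exists and is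
  unique.\<close>

definition wproj :: "real ^ 's \<Rightarrow> (real ^ 's) set \<Rightarrow> real ^ 's \<Rightarrow> real ^ 's::finite" where
  "wproj d U v = arg_min_on (\<lambda>u. wnorm d (u - v)) U"

end

theory Submission
  imports Defs
begin

text \<open>
  The matrix $L = P^\lambda_\pi$ equals $(I-\gamma\lambda P_\pi)^{-1}\,\gamma(1-\lambda)P_\pi$. A minimum
  principle for $I - cP_\pi$ with $0 \le c < 1$ shows that $L \ge 0$, and its rows sum to $\beta$. By
  Cauchy-Schwarz, $(Lv)(s)^2 \le \beta\,\sum_{s'} L(s,s')\,v(s')^2$. Summing with the weights $m$ and using
  $m^\top L = m^\top - \mathbf{i}^\top \le m^\top$ gives $\|Lv\|_m \le \sqrt\beta\,\|v\|_m$. The projection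
  is nonexpansive, because scaling by $\sqrt{m(s)}$ turns it into a Euclidean nearest-point map.
\<close>

section \<open>Stochasticity of the induced transition matrix\<close>

definition row_stochastic :: "real ^ 'n ^ 'n::finite \<Rightarrow> bool" where
  "row_stochastic Q \<longleftrightarrow> (\<forall>s s'. 0 \<le> Q $ s $ s') \<and> (\<forall>s. (\<Sum>s'\<in>UNIV. Q $ s $ s') = 1)"

text \<open>Each row is the law of the next state, so stochasticity is inherited from
  \<open>bind_pmf\<close>. The terms are dominated by \<open>pmf (\<pi> s) a\<close>; this absolute
  summability identifies \<open>infsum\<close> with the sum that describes the expectation, also for
  an infinite action type.\<close>

lemma trans_matrix_eq_pmf_bind:
  "trans_matrix P \<pi> $ s $ s' = pmf (bind_pmf (\<pi> s) (P s)) s'"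
proof -
  let ?f = "\<lambda>a. pmf (\<pi> s) a * pmf (P s a) s'"
  have "Infinite_Set_Sum.abs_summable_on ?f UNIV"
    by (rule abs_summable_on_comparison_test[OF pmf_abs_summable[of "\<pi> s"]])
       (simp add: mult_left_le pmf_le_1)
  then have "infsetsum ?f UNIV = infsum ?f UNIV"
    by (rule infsetsum_infsum)
  then show ?thesis
    by (simp add: trans_matrix_def pmf_bind pmf_expectation_eq_infsetsum)
qed

lemma row_stochastic_trans_matrix: "row_stochastic (trans_matrix P \<pi>)"
  by (simp add: row_stochastic_def trans_matrix_eq_pmf_bind sum_pmf_eq_1)

lemma row_stochastic_ones:
  assumes "row_stochastic Q"
  shows "Q *v 1 = 1"
  using assms by (simp add: row_stochastic_def vec_eq_iff matrix_vector_mult_def)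

section \<open>Discounted matrices I - c Q\<close>

lemma discounted_matrix_vector_nth:
  fixes Q :: "real ^ 'n ^ 'n::finite"
  shows "((mat 1 - c *\<^sub>R Q) *v x) $ s = x $ s - c * (\<Sum>s'\<in>UNIV. Q $ s $ s' * x $ s')"
  by (simp add: matrix_vector_mult_diff_rdistrib scaleR_matrix_vector_assoc[symmetric])
     (simp add: matrix_vector_mult_def)

text \<open>Let \<open>x\<close> attain its minimum \<open>t\<close> at \<open>r\<close>. Row
  \<open>r\<close> of \<open>Q\<close> averages values that are at least \<open>t\<close>, so the
  hypothesis at \<open>r\<close> gives 0 \<le> t - c t, and c < 1 forces t \<ge> 0.\<close>

lemma minimum_principle:
  fixes x :: "real ^ 'n::finite"
  assumes Q: "row_stochastic Q" and c: "0 \<le> c" "c < 1"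
    and nonneg: "\<And>s. 0 \<le> ((mat 1 - c *\<^sub>R Q) *v x) $ s"
  shows "0 \<le> x $ s"
proof -
  define t where "t = Min (range (($) x))"
  have t_le: "t \<le> x $ s" for s
    unfolding t_def by (rule Min_le) auto
  have "t \<in> range (($) x)"
    unfolding t_def by (rule Min_in) auto
  then obtain r where r: "t = x $ r"
    by auto
  have "t = (\<Sum>s'\<in>UNIV. Q $ r $ s' * t)"
    using Q by (simp add: row_stochastic_def flip: sum_distrib_right)
  also have "\<dots> \<le> (\<Sum>s'\<in>UNIV. Q $ r $ s' * x $ s')"
    using Q t_le by (intro sum_mono mult_left_mono) (auto simp: row_stochastic_def)
  finally have "c * t \<le> c * (\<Sum>s'\<in>UNIV. Q $ r $ s' * x $ s')"
    using c by (intro mult_left_mono)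
  then have "0 \<le> (1 - c) * t"
    using nonneg[of r] unfolding discounted_matrix_vector_nth r by (simp add: left_diff_distrib)
  then have "0 \<le> t"
    using c by (simp add: zero_le_mult_iff)
  then show ?thesis
    using t_le[of s] by simp
qed

text \<open>The minimum principle applied to both \<open>x\<close> and \<open>- x\<close> shows that
  the kernel is trivial, which suffices for a square matrix.\<close>

lemma invertible_discounted:
  fixes Q :: "real ^ 'n ^ 'n::finite"
  assumes Q: "row_stochastic Q" and c: "0 \<le> c" "c < 1"
  shows "invertible (mat 1 - c *\<^sub>R Q)"
proof -
  let ?A = "mat 1 - c *\<^sub>R Q"
  have "x = 0" if x: "?A *v x = 0" for x
  proof -
    have "?A *v (- x) = 0"
      using x matrix_vector_mult_diff_distrib[of ?A 0 x] by simp
    then have "0 \<le> (- x) $ s" for s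
      by (metis Q c minimum_principle order_refl zero_index)
    moreover have "0 \<le> x $ s" for s
      using x by (metis Q c minimum_principle order_refl zero_index)
    ultimately show "x = 0"
      by (simp add: vec_eq_iff antisym)
  qed
  then show ?thesis
    by (simp add: invertible_left_inverse matrix_left_invertible_ker)
qed

section \<open>Inverses, \<open>lambda_matrix\<close> and the emphasis\<close>

lemma matrix_inv_left:
  fixes A :: "'a::field ^ 'n ^ 'n::finite"
  assumes "invertible A"
  shows "matrix_inv A ** A = mat 1"
  using assms unfolding invertible_def matrix_inv_def by (rule someI2_ex) simp

lemma matrix_inv_right:
  fixes A :: "'a::field ^ 'n ^ 'n::finite"
  assumes "invertible A"
  shows "A ** matrix_inv A = mat 1"
  using assms unfolding invertible_def matrix_inv_def by (rule someI2_ex) simp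

text \<open>Multiplying by I - \<gamma> lam Q clears the inverse and leaves (I - \<gamma> lam Q) -
  (I - \<gamma> Q) = \<gamma> (1 - lam) Q. In this form the minimum principle applies to
  \<open>lambda_matrix\<close> without a Neumann series.\<close>

lemma discounted_lambda_matrix:
  fixes Q :: "real ^ 'n ^ 'n::finite"
  assumes Q: "row_stochastic Q" and c: "0 \<le> \<gamma> * lam" "\<gamma> * lam < 1"
  shows "(mat 1 - (\<gamma> * lam) *\<^sub>R Q) *v (lambda_matrix \<gamma> lam Q *v x)
    = (\<gamma> * (1 - lam)) *\<^sub>R (Q *v x)"
proof -
  let ?A = "mat 1 - (\<gamma> * lam) *\<^sub>R Q"
  have "?A *v (lambda_matrix \<gamma> lam Q *v x)
      = ?A *v x - (?A ** matrix_inv ?A) *v ((mat 1 - \<gamma> *\<^sub>R Q) *v x)"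
    by (simp add: lambda_matrix_def matrix_vector_mult_diff_rdistrib
        matrix_vector_mult_diff_distrib matrix_vector_mul_assoc[symmetric])
  also have "\<dots> = (\<gamma> * (1 - lam)) *\<^sub>R (Q *v x)"
    by (simp add: matrix_inv_right[OF invertible_discounted[OF Q c]] matrix_vector_mult_diff_rdistrib
        right_diff_distrib scaleR_left_diff_distrib flip: scaleR_matrix_vector_assoc)
  finally show ?thesis .
qed

context
  fixes Q :: "real ^ 'n ^ 'n::finite" and \<gamma> lam :: real
  assumes Q: "row_stochastic Q"
    and \<gamma>: "0 \<le> \<gamma>" "\<gamma> < 1" and lam: "0 \<le> lam" "lam < 1"
begin

lemma discount_product: "0 \<le> \<gamma> * lam" "\<gamma> * lam < 1"
  using \<gamma> lam mult_left_le[of lam \<gamma>] by simp_all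

text \<open>Column \<open>s'\<close> is the image of the unit vector \<open>axis s' 1\<close>. The
  discounted matrix sends it to a nonnegative multiple of column \<open>s'\<close> of
  \<open>Q\<close>, so the minimum principle applies.\<close>

lemma lambda_matrix_nonneg: "0 \<le> lambda_matrix \<gamma> lam Q $ s $ s'"
proof -
  have "0 \<le> (lambda_matrix \<gamma> lam Q *v axis s' 1) $ s"
  proof (rule minimum_principle[OF Q discount_product])
    fix r
    show "0 \<le> ((mat 1 - (\<gamma> * lam) *\<^sub>R Q) *v (lambda_matrix \<gamma> lam Q *v axis s' 1)) $ r"
      using Q \<gamma> lam unfolding discounted_lambda_matrix[OF Q discount_product]
      by (simp add: matrix_vector_mul_component inner_axis row_stochastic_def)
  qed
  then show ?thesis
    by (simp add: matrix_vector_mul_component inner_axis)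
qed

text \<open>The discounted matrix sends both the vector of row sums and the constant vector
  \<open>?\<beta>\<close> to the constant \<gamma> (1 - lam); it is injective, so they
  agree.\<close>

lemma lambda_matrix_row_sum:
  "(\<Sum>s'\<in>UNIV. lambda_matrix \<gamma> lam Q $ s $ s') = \<gamma> * (1 - lam) / (1 - lam * \<gamma>)"
proof -
  let ?A = "mat 1 - (\<gamma> * lam) *\<^sub>R Q" and ?L = "lambda_matrix \<gamma> lam Q"
  let ?\<beta> = "\<gamma> * (1 - lam) / (1 - lam * \<gamma>)"
  \<comment> \<open>The all-ones vector is fixed by \<open>Q\<close>, hence an eigenvector of
    \<open>?A\<close>; its eigenvalue is the denominator of \<open>?\<beta>\<close>.\<close>
  have "?A *v 1 = (1 - \<gamma> * lam) *\<^sub>R 1"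
    by (simp add: matrix_vector_mult_diff_rdistrib row_stochastic_ones[OF Q] scaleR_left_diff_distrib
        flip: scaleR_matrix_vector_assoc)
  then have "?A *v (?\<beta> *\<^sub>R 1) = ((1 - \<gamma> * lam) * ?\<beta>) *\<^sub>R 1"
    by (simp add: matrix_vector_mult_scaleR mult.commute)
  also have "\<dots> = ?A *v (?L *v 1)"
    using discount_product
    by (simp add: discounted_lambda_matrix[OF Q discount_product] row_stochastic_ones[OF Q]
        mult.commute)
  finally have "?L *v 1 = ?\<beta> *\<^sub>R 1"
    using invertible_discounted[OF Q discount_product]
    by (metis matrix_inv_left matrix_vector_mul_assoc matrix_vector_mul_lid)
  then have "(?L *v 1) $ s = (?\<beta> *\<^sub>R 1) $ s"
    by simp
  then show ?thesis
    by (simp add: matrix_vector_mult_def)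
qed

text \<open>Here I - \<open>lambda_matrix\<close> is \<open>matrix_inv ?A ** ?B\<close>, a product
  of invertible matrices, so the inverse in the definition of \<open>emphasis\<close> really
  cancels.\<close>

lemma emphasis_equation:
  "emphasis \<gamma> lam Q i d v* (mat 1 - lambda_matrix \<gamma> lam Q) = (\<chi> s. i s * d $ s)"
proof -
  let ?B = "mat 1 - \<gamma> *\<^sub>R Q" and ?A = "mat 1 - (\<gamma> * lam) *\<^sub>R Q"
  have A: "matrix_inv ?A ** ?A = mat 1" "?A ** matrix_inv ?A = mat 1"
    using invertible_discounted[OF Q discount_product]
    by (auto intro: matrix_inv_left matrix_inv_right)
  have "invertible (matrix_inv ?A ** ?B)"
    using A by (intro invertible_mult invertible_discounted[OF Q \<gamma>]) (auto simp: invertible_def)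
  then show ?thesis
    by (simp add: emphasis_def lambda_matrix_def vector_matrix_mul_assoc matrix_inv_left)
qed

text \<open>By the emphasis equation the two sides differ by exactly \<open>i s' * d $ s'\<close>,
  which is nonnegative.\<close>

lemma emphasis_lambda_matrix_le:
  assumes "\<And>s. 0 \<le> i s" and "\<And>s. 0 \<le> d $ s"
  defines "m \<equiv> emphasis \<gamma> lam Q i d"
  shows "(\<Sum>s\<in>UNIV. m $ s * lambda_matrix \<gamma> lam Q $ s $ s') \<le> m $ s'"
proof -
  let ?L = "lambda_matrix \<gamma> lam Q"
  have "m v* (mat 1 - ?L) = m v* mat 1 - m v* ?L"
    by (simp add: vec_eq_iff vector_matrix_mult_def sum_subtractf algebra_simps)
  then have "(m v* ?L) $ s' = m $ s' - i s' * d $ s'"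
    using emphasis_equation[of i d] by (simp add: m_def vec_eq_iff algebra_simps)
  then show ?thesis
    using assms(1,2) by (simp add: vector_matrix_mult_def mult.commute)
qed

end

section \<open>Nonnegative matrices in a weighted norm\<close>

lemma wnorm_matrix_vector_le:
  fixes L :: "real ^ 'n ^ 'n::finite"
  assumes L: "\<And>s s'. 0 \<le> L $ s $ s'"
    and row: "\<And>s. (\<Sum>s'\<in>UNIV. L $ s $ s') \<le> \<beta>"
    and m: "\<And>s. 0 \<le> m $ s"
    and sub: "\<And>s'. (\<Sum>s\<in>UNIV. m $ s * L $ s $ s') \<le> m $ s'"
  shows "wnorm m (L *v v) \<le> sqrt \<beta> * wnorm m v"
proof -
  \<comment> \<open>Any row sum is a nonnegative lower bound for \<open>\<beta>\<close>;
    \<open>undefined\<close> merely names some row.\<close>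
  have \<beta>: "0 \<le> \<beta>"
    using row[of undefined] by (rule order_trans[rotated]) (simp add: L sum_nonneg)
  have jensen: "((L *v v) $ s)\<^sup>2 \<le> \<beta> * (\<Sum>s'\<in>UNIV. L $ s $ s' * (v $ s')\<^sup>2)" for s
  proof -
    \<comment> \<open>Splitting each entry of \<open>L\<close> into two square roots makes the first
      Cauchy-Schwarz factor the row sum.\<close>
    have "((L *v v) $ s)\<^sup>2 = (\<Sum>s'\<in>UNIV. sqrt (L $ s $ s') * (sqrt (L $ s $ s') * v $ s'))\<^sup>2"
      by (simp add: matrix_vector_mult_def L flip: mult.assoc)
    also have "\<dots> \<le> (\<Sum>s'\<in>UNIV. (sqrt (L $ s $ s'))\<^sup>2) * (\<Sum>s'\<in>UNIV. (sqrt (L $ s $ s') * v $ s')\<^sup>2)"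
      by (rule Cauchy_Schwarz_ineq_sum)
    also have "\<dots> = (\<Sum>s'\<in>UNIV. L $ s $ s') * (\<Sum>s'\<in>UNIV. L $ s $ s' * (v $ s')\<^sup>2)"
      by (simp add: L power_mult_distrib)
    also have "\<dots> \<le> \<beta> * (\<Sum>s'\<in>UNIV. L $ s $ s' * (v $ s')\<^sup>2)"
      by (intro mult_right_mono row sum_nonneg) (simp add: L)
    finally show ?thesis .
  qed
  have "(\<Sum>s\<in>UNIV. m $ s * ((L *v v) $ s)\<^sup>2)
      \<le> (\<Sum>s\<in>UNIV. m $ s * (\<beta> * (\<Sum>s'\<in>UNIV. L $ s $ s' * (v $ s')\<^sup>2)))"
    by (intro sum_mono mult_left_mono jensen m)
  also have "\<dots> = \<beta> * (\<Sum>s\<in>UNIV. \<Sum>s'\<in>UNIV. m $ s * L $ s $ s' * (v $ s')\<^sup>2)"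
    by (simp add: sum_distrib_left algebra_simps)
  \<comment> \<open>Exchanging the sums isolates the entries of \<open>m v* L\<close>, which
    \<open>sub\<close> bounds by those of \<open>m\<close>.\<close>
  also have "\<dots> = \<beta> * (\<Sum>s'\<in>UNIV. (\<Sum>s\<in>UNIV. m $ s * L $ s $ s') * (v $ s')\<^sup>2)"
    by (subst sum.swap) (simp add: sum_distrib_right)
  also have "\<dots> \<le> \<beta> * (\<Sum>s'\<in>UNIV. m $ s' * (v $ s')\<^sup>2)"
    by (intro mult_left_mono \<beta> sum_mono mult_right_mono sub) simp
  finally show ?thesis
    by (simp add: wnorm_def flip: real_sqrt_mult)
qed

section \<open>Weighted projection as a nearest-point map\<close>

definition weight_scale :: "real ^ 'n \<Rightarrow> real ^ 'n \<Rightarrow> real ^ 'n::finite" where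
  "weight_scale d v = (\<chi> s. sqrt (d $ s) * v $ s)"

lemma linear_weight_scale: "linear (weight_scale d)"
  by (rule linearI) (simp_all add: weight_scale_def vec_eq_iff algebra_simps)

lemma wnorm_eq_norm_weight_scale:
  assumes "\<And>s. 0 \<le> d $ s"
  shows "wnorm d v = norm (weight_scale d v)"
  by (simp add: wnorm_def weight_scale_def norm_vec_def L2_set_def power_mult_distrib assms)

lemma weight_scale_wproj:
  assumes d: "\<And>s. 0 \<le> d $ s" and U: "subspace U"
  shows "weight_scale d (wproj d U v) = closest_point (weight_scale d ` U) (weight_scale d v)"
proof -
  let ?D = "weight_scale d"
  have sub: "subspace (?D ` U)"
    by (rule linear_subspace_image[OF linear_weight_scale U])
  then have ne: "?D ` U \<noteq> {}" and cl: "closed (?D ` U)" and cv: "convex (?D ` U)"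
    using U by (auto simp: closed_subspace subspace_imp_convex dest: subspace_0)
  have dist: "wnorm d (u - v) = dist (?D v) (?D u)" for u
    by (simp add: wnorm_eq_norm_weight_scale[OF d] linear_diff[OF linear_weight_scale]
        dist_norm norm_minus_commute)
  \<comment> \<open>A preimage of the nearest point witnesses that a minimizer exists, so the choice
    made by \<open>arg_min_on\<close> is itself a minimizer.\<close>
  obtain u where u: "u \<in> U" "?D u = closest_point (?D ` U) (?D v)"
    using closest_point_in_set[OF cl ne, of "?D v"] by (metis imageE)
  then have "is_arg_min (\<lambda>u. wnorm d (u - v)) (\<lambda>u. u \<in> U) u"
    using closest_point_exists(2)[OF cl ne, of "?D v"] by (auto simp: is_arg_min_linorder dist)
  then have "is_arg_min (\<lambda>u. wnorm d (u - v)) (\<lambda>u. u \<in> U) (wproj d U v)"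
    unfolding wproj_def arg_min_on_def arg_min_def by (rule someI)
  then show ?thesis
    by (intro closest_point_unique cv cl) (auto simp: is_arg_min_linorder dist)
qed

lemma wproj_nonexpansive:
  assumes d: "\<And>s. 0 \<le> d $ s" and U: "subspace U"
  shows "wnorm d (wproj d U v - wproj d U w) \<le> wnorm d (v - w)"
proof -
  let ?D = "weight_scale d"
  have sub: "subspace (?D ` U)"
    by (rule linear_subspace_image[OF linear_weight_scale U])
  then have "?D ` U \<noteq> {}"
    using U by (auto dest: subspace_0)
  then have "dist (closest_point (?D ` U) (?D v)) (closest_point (?D ` U) (?D w)) \<le> dist (?D v) (?D w)"
    using sub by (intro closest_point_lipschitz) (auto simp: closed_subspace subspace_imp_convex)
  then show ?thesis
    by (simp add: wnorm_eq_norm_weight_scale[OF d] linear_diff[OF linear_weight_scale]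
        weight_scale_wproj[OF d U] dist_norm)
qed

lemma subspace_feature_space: "subspace (feature_space \<phi>)"
  unfolding feature_space_def
  by (intro linear_subspace_image subspace_UNIV matrix_vector_mul_linear)

theorem theorem2:
  fixes P :: "'s::finite \<Rightarrow> 'a \<Rightarrow> 's pmf"
    and R :: "'s \<Rightarrow> 'a \<Rightarrow> real"
    and \<gamma> lam :: real
    and \<rho> :: "'s pmf"
    and \<pi> \<mu> :: "'s \<Rightarrow> 'a pmf"
    and d\<^sub>\<mu> m :: "real ^ 's"
    and i :: "'s \<Rightarrow> real"
    and \<phi> :: "'s \<Rightarrow> real ^ 'n::finite"
    and T Proj :: "real ^ 's \<Rightarrow> real ^ 's"
    and \<beta> :: real
  assumes "0 \<le> \<gamma>" and "\<gamma> < 1"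
    and "0 \<le> lam" and "lam < 1"
    and "ratios_well_defined P \<rho> \<pi> \<mu>"
    and "stationary_distribution (trans_matrix P \<mu>) d\<^sub>\<mu>"
    and "\<And>s. 0 \<le> i s"
    and "m = emphasis \<gamma> lam (trans_matrix P \<pi>) i d\<^sub>\<mu>"
    and "\<And>s. 0 < m $ s"
    and "T = bellman_lambda \<gamma> lam (trans_matrix P \<pi>) (reward_vector R \<pi>)"
    and "Proj = wproj m (feature_space \<phi>)"
    and "\<beta> = \<gamma> * (1 - lam) / (1 - lam * \<gamma>)"
  shows "\<forall>v\<^sub>1 v\<^sub>2. wnorm m (Proj (T v\<^sub>1) - Proj (T v\<^sub>2)) \<le> sqrt \<beta> * wnorm m (v\<^sub>1 - v\<^sub>2)"
proof (intro allI)
  fix v\<^sub>1 v\<^sub>2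
  let ?Q = "trans_matrix P \<pi>"
  let ?L = "lambda_matrix \<gamma> lam ?Q"
  note Q = row_stochastic_trans_matrix[of P \<pi>]
  have d: "0 \<le> d\<^sub>\<mu> $ s" for s
    using assms(6) by (simp add: stationary_distribution_def)
  have m: "0 \<le> m $ s" for s
    using assms(9) by (rule less_imp_le)
  have "wnorm m (Proj (T v\<^sub>1) - Proj (T v\<^sub>2)) \<le> wnorm m (T v\<^sub>1 - T v\<^sub>2)"
    unfolding assms(11) by (rule wproj_nonexpansive[OF m subspace_feature_space])
  \<comment> \<open>The reward term does not depend on the argument and cancels.\<close>
  also have "T v\<^sub>1 - T v\<^sub>2 = ?L *v (v\<^sub>1 - v\<^sub>2)"
    by (simp add: assms(10) bellman_lambda_def matrix_vector_mult_diff_distrib)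
  also have "wnorm m \<dots> \<le> sqrt \<beta> * wnorm m (v\<^sub>1 - v\<^sub>2)"
  proof (rule wnorm_matrix_vector_le)
    show "0 \<le> ?L $ s $ s'" for s s'
      by (rule lambda_matrix_nonneg[OF Q assms(1-4)])
    show "(\<Sum>s'\<in>UNIV. ?L $ s $ s') \<le> \<beta>" for s
      by (simp add: lambda_matrix_row_sum[OF Q assms(1-4)] assms(12))
    show "(\<Sum>s\<in>UNIV. m $ s * ?L $ s $ s') \<le> m $ s'" for s'
      unfolding assms(8) by (rule emphasis_lambda_matrix_le[OF Q assms(1-4,7) d])
  qed (rule m)
  finally show "wnorm m (Proj (T v\<^sub>1) - Proj (T v\<^sub>2)) \<le> sqrt \<beta> * wnorm m (v\<^sub>1 - v\<^sub>2)" .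
qed

end
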